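(* Let $(\mathcal{X},\|\cdot\|)$ be a finite-dimensional real normed vector space and let $T:\mathcal{X}\to\mathcal{X}$ be a nonexpansive map. Then the following are equivalent: (i) for every vector $g\in\mathcal{X}$, the map $g+T$ (i.e., $x\mapsto g+T(x)$) has a fixed point; (ii) every nonexpansive map $G:\mathcal{X}\to\mathcal{X}$ such that $\sup_{x\in\mathcal{X}}\|G(x)-T(x)\|<\infty$ has a fixed point; (iii) for every scalar $\alpha\geq0$, the set $\mathcal{D}_\alpha(T)=\{x\in\mathcal{X}\mid\|x-T(x)\|\leq\alpha\}$ is bounded.
   Context: A map $T:\mathcal{X}\to\mathcal{X}$ is nonexpansive if $\|T(x)-T(y)\|\leq\|x-y\|$ for all $x,y\in\mathcal{X}$. *)

theory Defs
  imports "HOL-Analysis.Analysis"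
begin

definition nonexpansive :: "('a::real_normed_vector \<Rightarrow> 'a) \<Rightarrow> bool" where
  "nonexpansive T \<longleftrightarrow> (\<forall>x y. norm (T x - T y) \<le> norm (x - y))"

definition approx_fixed_set :: "real \<Rightarrow> ('a::real_normed_vector \<Rightarrow> 'a) \<Rightarrow> 'a set" where
  "approx_fixed_set \<alpha> T = {x. norm (x - T x) \<le> \<alpha>}"

end

theory Submission
  imports Defs
begin

text \<open>
  For nonexpansive \<open>T\<close> the displacement \<open>x - T x\<close> is accretive. If it stays bounded along an
  unbounded sequence \<open>x n\<close>, then by compactness it tends to some \<open>y\<close> and \<open>sgn (x n)\<close> to some
  unit vector \<open>u\<close>, along a subsequence; the limit form of accretivity says that every
  displacement \<open>z - T z\<close> is at distance at least \<open>1\<close> from \<open>y + u\<close>, so the translate of \<open>T\<close> by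
  \<open>y + u\<close> has no fixed point.
  Conversely, the fixed points of the contractions \<open>\<lambda>x. c *\<^sub>R G x\<close> with \<open>c < 1\<close> are moved by \<open>G\<close>
  at most \<open>norm (G 0)\<close>. If the points with this property form a bounded set, the displacement at
  such a fixed point vanishes as \<open>c\<close> tends to \<open>1\<close>, and by compactness a point of minimal
  displacement exists; it is fixed by \<open>G\<close>.
\<close>

definition boundedly_compact :: "'a::metric_space set \<Rightarrow> bool" where
  "boundedly_compact S \<longleftrightarrow> (\<forall>K. closed K \<and> bounded K \<longrightarrow> compact (S \<inter> K))"

lemma boundedly_compactI_cball:
  fixes a :: "'a::metric_space"
  assumes "\<And>r. compact (S \<inter> cball a r)"
  shows "boundedly_compact S"
  unfolding boundedly_compact_def
proof (intro allI impI, elim conjE)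
  fix K :: "'a set"
  assume "closed K" "bounded K"
  then obtain r where "K \<subseteq> cball a r"
    unfolding bounded_any_center[where a = a] by (meson mem_cball subsetI)
  then have "S \<inter> K = (S \<inter> cball a r) \<inter> K"
    by blast
  then show "compact (S \<inter> K)"
    using assms \<open>closed K\<close> by (simp add: compact_Int_closed)
qed

lemma boundedly_compact_Int_cball:
  assumes "boundedly_compact S"
  shows "compact (S \<inter> cball a r)"
  using assms by (simp add: boundedly_compact_def)

lemma boundedly_compact_imp_complete:
  assumes "boundedly_compact S"
  shows "complete S"
proof (rule completeI)
  fix f :: "nat \<Rightarrow> 'a"
  assume f: "\<forall>n. f n \<in> S" "Cauchy f"
  have "compact (S \<inter> closure (range f))"
    using assms f(2) by (simp add: boundedly_compact_def cauchy_imp_bounded bounded_closure)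
  then have "complete (S \<inter> closure (range f))"
    by (rule compact_imp_complete)
  moreover have "\<forall>n. f n \<in> S \<inter> closure (range f)"
    using f(1) closure_subset by blast
  ultimately show "\<exists>l\<in>S. f \<longlonglongrightarrow> l"
    using f(2) by (meson IntD1 completeE)
qed

lemma infdist_subspace_le_norm:
  fixes b :: "'a::real_normed_vector"
  assumes "subspace S" "s \<in> S"
  shows "\<bar>a\<bar> * infdist b S \<le> norm (a *\<^sub>R b + s)"
proof (cases "a = 0")
  case False
  have "- (s /\<^sub>R a) \<in> S"
    using assms by (intro subspace_neg subspace_scale)
  then have "infdist b S \<le> norm (b + s /\<^sub>R a)"
    using infdist_le[of "- (s /\<^sub>R a)" S b] by (simp add: dist_norm)
  then have "\<bar>a\<bar> * infdist b S \<le> norm (a *\<^sub>R (b + s /\<^sub>R a))"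
    by (simp add: mult_left_mono)
  also have "a *\<^sub>R (b + s /\<^sub>R a) = a *\<^sub>R b + s"
    using False by (simp add: scaleR_add_right)
  finally show ?thesis .
qed simp

lemma bounded_decomposition_span_insert:
  fixes b :: "'a::real_normed_vector"
  assumes S: "subspace S" "closed S" "b \<notin> S"
    and x: "x \<in> span (insert b S)" "norm x \<le> r"
  defines "A \<equiv> r / infdist b S"
  obtains a s where "x = a *\<^sub>R b + s" "\<bar>a\<bar> \<le> A" "s \<in> S" "norm s \<le> r + A * norm b"
proof -
  obtain a where a: "x - a *\<^sub>R b \<in> S"
    using x(1) span_minimal[OF order_refl S(1)] by (auto simp: span_insert)
  have infdist_pos: "0 < infdist b S"
    using S subspace_0 by (blast intro: infdist_pos_not_in_closed)
  have "\<bar>a\<bar> * infdist b S \<le> r"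
    using infdist_subspace_le_norm[OF S(1) a, of a b] x(2) by simp
  then have coefficient: "\<bar>a\<bar> \<le> A"
    using infdist_pos by (simp add: A_def field_simps)
  have "norm (x - a *\<^sub>R b) \<le> norm x + \<bar>a\<bar> * norm b"
    using norm_triangle_ineq4[of x "a *\<^sub>R b"] by simp
  also have "\<dots> \<le> r + A * norm b"
    using x(2) coefficient by (intro add_mono mult_right_mono) auto
  finally show ?thesis
    using that[of a "x - a *\<^sub>R b"] a coefficient by simp
qed

lemma boundedly_compact_span_insert:
  fixes b :: "'a::real_normed_vector"
  assumes "subspace S" "boundedly_compact S"
  shows "boundedly_compact (span (insert b S))"
proof (cases "b \<in> S")
  case True
  then show ?thesis
    using assms by (simp add: insert_absorb span_eq_iff[THEN iffD2])
next
  case False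
  have "closed S"
    using assms(2) by (intro complete_imp_closed boundedly_compact_imp_complete)
  show ?thesis
  proof (rule boundedly_compactI_cball[where a = 0])
    fix r
    define A where "A = r / infdist b S"
    define K where
      "K = (\<lambda>(a, s). a *\<^sub>R b + s) ` ({- A..A} \<times> (S \<inter> cball 0 (r + A * norm b)))"
    have "compact K"
      unfolding K_def case_prod_unfold
      by (intro compact_continuous_image compact_Times boundedly_compact_Int_cball assms(2)
          compact_Icc continuous_intros)
    moreover have "K \<subseteq> span (insert b S)"
      unfolding K_def by (auto simp: span_add span_scale span_base)
    moreover have "span (insert b S) \<inter> cball 0 r \<subseteq> K"
    proof
      fix x
      assume "x \<in> span (insert b S) \<inter> cball 0 r"
      then obtain a s where "x = a *\<^sub>R b + s" "\<bar>a\<bar> \<le> A" "s \<in> S" "norm s \<le> r + A * norm b"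
        using bounded_decomposition_span_insert[OF assms(1) \<open>closed S\<close> False, of x r]
        by (auto simp: A_def)
      then show "x \<in> K"
        unfolding K_def by (intro rev_image_eqI[of "(a, s)"]) auto
    qed
    ultimately have "span (insert b S) \<inter> cball 0 r = K \<inter> cball 0 r"
      by blast
    then show "compact (span (insert b S) \<inter> cball 0 r)"
      using \<open>compact K\<close> by (simp add: compact_Int_closed)
  qed
qed

lemma boundedly_compact_span_finite:
  fixes B :: "'a::real_normed_vector set"
  assumes "finite B"
  shows "boundedly_compact (span B)"
  using assms
proof (induction B rule: finite_induct)
  case empty
  show ?case
    by (auto simp: boundedly_compact_def finite_imp_compact)
next
  case (insert b B)
  have "span (insert b B) = span (insert b (span B))"
    by (simp add: span_insert span_span)
  then show ?case
    using boundedly_compact_span_insert[OF subspace_span insert.IH] by simp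
qed

lemma unbounded_imp_sequence_at_infinity:
  fixes S :: "'a::real_normed_vector set"
  assumes "\<not> bounded S"
  obtains x :: "nat \<Rightarrow> 'a" where "\<And>n. x n \<in> S" "filterlim x at_infinity sequentially"
proof -
  have "\<exists>x\<in>S. real n < norm x" for n
    using assms unfolding bounded_iff by (force simp: not_le)
  then obtain x where x: "\<And>n. x n \<in> S" "\<And>n. real n < norm (x n)"
    by metis
  have "filterlim (\<lambda>n. norm (x n)) at_top sequentially"
    using x(2) by (intro filterlim_at_top_mono[OF filterlim_real_sequentially] always_eventually)
      (simp add: less_imp_le)
  then show ?thesis
    using x(1) that filterlim_norm_at_top_imp_at_infinity by blast
qed

lemma nonexpansiveD:
  assumes "nonexpansive T"
  shows "norm (T x - T y) \<le> norm (x - y)"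
  using assms by (simp add: nonexpansive_def)

lemma nonexpansive_translate:
  assumes "nonexpansive T"
  shows "nonexpansive (\<lambda>x. g + T x)"
  using assms by (simp add: nonexpansive_def)

lemma nonexpansive_imp_continuous_on:
  assumes "nonexpansive T"
  shows "continuous_on S T"
proof -
  have "1-lipschitz_on S T"
    using nonexpansiveD[OF assms] by (intro lipschitz_onI) (auto simp: dist_norm)
  then show ?thesis
    by (rule lipschitz_on_continuous_on)
qed

lemma nonexpansive_displacement_accretive:
  assumes "nonexpansive T" "0 \<le> t"
  shows "norm (t *\<^sub>R (x - z)) \<le> norm (t *\<^sub>R (x - z) + ((x - T x) - (z - T z)))"
    (is "_ \<le> norm ?w")
proof -
  have "t * norm (x - z) + norm (x - z) = norm ((t + 1) *\<^sub>R (x - z))"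
    using assms(2) by (simp add: distrib_right)
  also have "(t + 1) *\<^sub>R (x - z) = ?w + (T x - T z)"
    by (simp add: scaleR_add_left)
  also have "norm \<dots> \<le> norm ?w + norm (x - z)"
    using nonexpansiveD[OF assms(1)] by (rule norm_triangle_mono[OF order_refl])
  finally show ?thesis
    using assms(2) by simp
qed

lemma tendsto_diff_over_norm_at_infinity:
  fixes x :: "'b \<Rightarrow> 'a::real_normed_vector"
  assumes "filterlim x at_infinity F" "((\<lambda>n. sgn (x n)) \<longlongrightarrow> u) F"
  shows "((\<lambda>n. inverse (norm (x n)) *\<^sub>R (x n - z)) \<longlongrightarrow> u) F"
proof -
  have "((\<lambda>n. sgn (x n) - inverse (norm (x n)) *\<^sub>R z) \<longlongrightarrow> u - 0 *\<^sub>R z) F"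
    using assms
    by (intro tendsto_intros tendsto_inverse_0_at_top filterlim_at_infinity_imp_norm_at_top)
  then show ?thesis
    by (simp add: sgn_div_norm scaleR_diff_right)
qed

lemma norm_sgn_limit_at_infinity:
  fixes x :: "'b \<Rightarrow> 'a::real_normed_vector"
  assumes "F \<noteq> bot" "filterlim x at_infinity F" "((\<lambda>n. sgn (x n)) \<longlongrightarrow> u) F"
  shows "norm u = 1"
proof -
  have "\<forall>\<^sub>F n in F. x n \<noteq> 0"
    using assms(2) by (rule filterlim_at_infinity_imp_eventually_ne)
  then have "\<forall>\<^sub>F n in F. norm (sgn (x n)) = 1"
    by eventually_elim (simp add: norm_sgn)
  then have "((\<lambda>n. norm (sgn (x n))) \<longlongrightarrow> 1) F"
    by (rule tendsto_eventually)
  then show ?thesis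
    using tendsto_norm[OF assms(3)] assms(1) tendsto_unique by blast
qed

lemma nonexpansive_displacement_gap:
  assumes "nonexpansive T" "F \<noteq> bot" "filterlim x at_infinity F"
    and "((\<lambda>n. x n - T (x n)) \<longlongrightarrow> y) F" "((\<lambda>n. sgn (x n)) \<longlongrightarrow> u) F"
  shows "1 \<le> norm (y + u - (z - T z))"
proof -
  define p where "p n = inverse (norm (x n)) *\<^sub>R (x n - z)" for n
  have "(p \<longlongrightarrow> u) F"
    unfolding p_def using assms(3,5) by (rule tendsto_diff_over_norm_at_infinity)
  have "norm (p n) \<le> norm (p n + ((x n - T (x n)) - (z - T z)))" for n
    unfolding p_def using assms(1) by (intro nonexpansive_displacement_accretive) simp_all
  moreover have "((\<lambda>n. norm (p n + ((x n - T (x n)) - (z - T z)))) \<longlongrightarrow>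
      norm (u + (y - (z - T z)))) F"
    by (intro tendsto_intros \<open>(p \<longlongrightarrow> u) F\<close> assms(4))
  ultimately have "norm u \<le> norm (u + (y - (z - T z)))"
    using tendsto_norm[OF \<open>(p \<longlongrightarrow> u) F\<close>] assms(2) by (simp add: tendsto_le)
  then show ?thesis
    using norm_sgn_limit_at_infinity[OF assms(2,3,5)] by (simp add: algebra_simps)
qed

lemma unbounded_approx_fixed_set_imp_displacement_gap:
  fixes T :: "'a::real_normed_vector \<Rightarrow> 'a"
  assumes "boundedly_compact (UNIV :: 'a set)" "nonexpansive T"
    and "\<not> bounded (approx_fixed_set \<alpha> T)"
  obtains g where "\<And>z. 1 \<le> norm (g - (z - T z))"
proof -
  obtain x where "\<And>n. x n \<in> approx_fixed_set \<alpha> T" and x_inf: "filterlim x at_infinity sequentially"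
    using unbounded_imp_sequence_at_infinity[OF assms(3)] by blast
  then have in_balls: "\<forall>n. (x n - T (x n), sgn (x n)) \<in> cball 0 \<alpha> \<times> cball 0 1"
    by (simp add: approx_fixed_set_def norm_sgn)
  have "seq_compact (cball (0::'a) \<alpha> \<times> cball (0::'a) 1)"
    using boundedly_compact_Int_cball[OF assms(1)]
    by (simp add: compact_Times compact_imp_seq_compact)
  then obtain l \<phi> where \<phi>: "strict_mono (\<phi> :: nat \<Rightarrow> nat)"
    and lim: "((\<lambda>n. (x n - T (x n), sgn (x n))) \<circ> \<phi>) \<longlonglongrightarrow> l"
    using in_balls by (rule seq_compactE)
  have "filterlim (\<lambda>n. x (\<phi> n)) at_infinity sequentially"
    using x_inf filterlim_subseq[OF \<phi>] by (rule filterlim_compose)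
  moreover have "(\<lambda>n. x (\<phi> n) - T (x (\<phi> n))) \<longlonglongrightarrow> fst l" "(\<lambda>n. sgn (x (\<phi> n))) \<longlonglongrightarrow> snd l"
    using tendsto_fst[OF lim] tendsto_snd[OF lim] by (simp_all add: o_def)
  ultimately show ?thesis
    using nonexpansive_displacement_gap[OF assms(2) sequentially_bot] that by blast
qed

lemma bounded_approx_fixed_set_if_translates_fixed:
  fixes T :: "'a::real_normed_vector \<Rightarrow> 'a"
  assumes "boundedly_compact (UNIV :: 'a set)" "nonexpansive T"
    and fixed: "\<And>g. \<exists>x. g + T x = x"
  shows "bounded (approx_fixed_set \<alpha> T)"
proof (rule ccontr)
  assume "\<not> bounded (approx_fixed_set \<alpha> T)"
  then obtain g where gap: "\<And>z. 1 \<le> norm (g - (z - T z))"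
    using unbounded_approx_fixed_set_imp_displacement_gap[OF assms(1,2)] by blast
  obtain z where "g + T z = z"
    using fixed by blast
  then have "g - (z - T z) = 0"
    by (simp add: algebra_simps)
  then show False
    using gap[of z] by simp
qed

lemma nonexpansive_norm_le:
  assumes "nonexpansive G"
  shows "norm (G x) \<le> norm x + norm (G 0)"
  using nonexpansiveD[OF assms, of x 0] norm_triangle_sub[of "G x" "G 0"] by simp

lemma nonexpansive_scaleR_fixed_point:
  fixes G :: "'a::real_normed_vector \<Rightarrow> 'a"
  assumes "complete (UNIV :: 'a set)" "nonexpansive G" "0 \<le> c" "c < 1"
  obtains x where "c *\<^sub>R G x = x"
proof -
  have "\<exists>!x\<in>UNIV. c *\<^sub>R G x = x"
  proof (rule Banach_fix[OF assms(1) UNIV_not_empty assms(3,4) subset_UNIV])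
    show "dist (c *\<^sub>R G x) (c *\<^sub>R G y) \<le> c * dist x y" for x y
      using nonexpansiveD[OF assms(2)] assms(3)
      by (simp add: dist_norm mult_left_mono flip: scaleR_diff_right)
  qed
  then show ?thesis
    using that by blast
qed

lemma norm_displacement_scaleR_fixed_point:
  fixes G :: "'a::real_normed_vector \<Rightarrow> 'a"
  assumes "c *\<^sub>R G x = x" "c \<le> 1"
  shows "norm (x - G x) = (1 - c) * norm (G x)"
proof -
  have "x - G x = - ((1 - c) *\<^sub>R G x)"
    using assms(1) by (simp add: scaleR_diff_left)
  then show ?thesis
    using assms(2) by simp
qed

lemma scaleR_fixed_point_in_approx_fixed_set:
  assumes "nonexpansive G" "c *\<^sub>R G x = x" "0 \<le> c" "c \<le> 1"
  shows "x \<in> approx_fixed_set (norm (G 0)) G"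
proof -
  have "norm x = c * norm (G x)"
    using assms(2,3) by (metis norm_scaleR abs_of_nonneg)
  then have "(1 - c) * norm (G x) \<le> norm (G 0)"
    using nonexpansive_norm_le[OF assms(1), of x] by (simp add: algebra_simps)
  then show ?thesis
    using norm_displacement_scaleR_fixed_point[of c G x] assms(2,4) by (simp add: approx_fixed_set_def)
qed

lemma nonexpansive_approx_fixed_set_nonempty:
  fixes G :: "'a::real_normed_vector \<Rightarrow> 'a"
  assumes "complete (UNIV :: 'a set)" "nonexpansive G"
    and "bounded (approx_fixed_set (norm (G 0)) G)" "0 < \<epsilon>"
  shows "approx_fixed_set \<epsilon> G \<noteq> {}"
proof -
  obtain R where "R > 0" and R: "\<And>x. x \<in> approx_fixed_set (norm (G 0)) G \<Longrightarrow> norm x \<le> R"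
    using assms(3) unfolding bounded_pos by blast
  define M where "M = R + norm (G 0)"
  define c where "c = M / (\<epsilon> + M)"
  have "M > 0"
    using \<open>R > 0\<close> by (simp add: M_def add_pos_nonneg)
  then have c: "0 \<le> c" "c < 1" "(1 - c) * M \<le> \<epsilon>"
    using assms(4) by (simp_all add: c_def field_simps)
  obtain x where x: "c *\<^sub>R G x = x"
    using nonexpansive_scaleR_fixed_point[OF assms(1,2) c(1,2)] .
  then have "norm x \<le> R"
    using scaleR_fixed_point_in_approx_fixed_set[OF assms(2)] c(1,2) R by simp
  then have "norm (G x) \<le> M"
    using nonexpansive_norm_le[OF assms(2), of x] by (simp add: M_def)
  have "norm (x - G x) = (1 - c) * norm (G x)"
    using norm_displacement_scaleR_fixed_point[of c G x] x c(2) by simp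
  also have "\<dots> \<le> (1 - c) * M"
    using \<open>norm (G x) \<le> M\<close> c(2) by (simp add: mult_left_mono)
  also have "\<dots> \<le> \<epsilon>"
    by (rule c(3))
  finally show ?thesis
    by (auto simp: approx_fixed_set_def)
qed

lemma compact_approx_fixed_set:
  fixes G :: "'a::real_normed_vector \<Rightarrow> 'a"
  assumes "boundedly_compact (UNIV :: 'a set)" "nonexpansive G" "bounded (approx_fixed_set \<alpha> G)"
  shows "compact (approx_fixed_set \<alpha> G)"
proof -
  have "closed (approx_fixed_set \<alpha> G)"
    unfolding approx_fixed_set_def
    by (intro closed_Collect_le continuous_intros nonexpansive_imp_continuous_on[OF assms(2)])
  then show ?thesis
    using assms(1,3) unfolding boundedly_compact_def by (metis Int_UNIV_left)
qed

lemma nonexpansive_fixed_point: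
  fixes G :: "'a::real_normed_vector \<Rightarrow> 'a"
  assumes "boundedly_compact (UNIV :: 'a set)" "nonexpansive G"
    and "bounded (approx_fixed_set (norm (G 0)) G)"
  obtains x where "G x = x"
proof -
  let ?D = "approx_fixed_set (norm (G 0)) G"
  have "0 \<in> ?D"
    by (simp add: approx_fixed_set_def)
  then have "?D \<noteq> {}"
    by blast
  moreover have "continuous_on ?D (\<lambda>x. norm (x - G x))"
    by (intro continuous_intros nonexpansive_imp_continuous_on[OF assms(2)])
  ultimately obtain x where x: "x \<in> ?D" "\<And>z. z \<in> ?D \<Longrightarrow> norm (x - G x) \<le> norm (z - G z)"
    using continuous_attains_inf[OF compact_approx_fixed_set[OF assms]] by blast
  have minimal: "norm (x - G x) \<le> norm (z - G z)" for z
    using x by (cases "z \<in> ?D") (auto simp: approx_fixed_set_def)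
  have "norm (x - G x) \<le> 0"
  proof (rule field_le_epsilon)
    fix \<epsilon> :: real
    assume "0 < \<epsilon>"
    obtain z where "norm (z - G z) \<le> \<epsilon>"
      using nonexpansive_approx_fixed_set_nonempty[OF _ assms(2,3) \<open>0 < \<epsilon>\<close>]
        boundedly_compact_imp_complete[OF assms(1)]
      by (auto simp: approx_fixed_set_def)
    then show "norm (x - G x) \<le> 0 + \<epsilon>"
      using minimal[of z] by linarith
  qed
  then have "G x = x"
    by simp
  then show ?thesis
    by (rule that)
qed

lemma approx_fixed_set_perturbation_subset:
  assumes "\<And>x. norm (G x - T x) \<le> M"
  shows "approx_fixed_set \<alpha> G \<subseteq> approx_fixed_set (\<alpha> + M) T"
proof
  fix x
  assume "x \<in> approx_fixed_set \<alpha> G"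
  then have "norm ((x - G x) + (G x - T x)) \<le> \<alpha> + M"
    using assms by (intro norm_triangle_mono) (auto simp: approx_fixed_set_def)
  then show "x \<in> approx_fixed_set (\<alpha> + M) T"
    by (simp add: approx_fixed_set_def)
qed

lemma bounded_perturbation_fixed_point:
  fixes T :: "'a::real_normed_vector \<Rightarrow> 'a"
  assumes "boundedly_compact (UNIV :: 'a set)" "nonexpansive G"
    and "bdd_above (range (\<lambda>x. norm (G x - T x)))"
    and bounded: "\<And>\<alpha>. 0 \<le> \<alpha> \<Longrightarrow> bounded (approx_fixed_set \<alpha> T)"
  obtains x where "G x = x"
proof -
  obtain M where M: "\<And>x. norm (G x - T x) \<le> M"
    using assms(3) unfolding bdd_above_def by auto
  have "0 \<le> M"
    using M[of 0] norm_ge_zero order_trans by blast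
  then have "bounded (approx_fixed_set (norm (G 0) + M) T)"
    by (intro bounded) simp
  then have "bounded (approx_fixed_set (norm (G 0)) G)"
    using approx_fixed_set_perturbation_subset[OF M] by (rule bounded_subset)
  then show ?thesis
    using nonexpansive_fixed_point[OF assms(1,2)] that by blast
qed

theorem corollary4p2:
  fixes T :: "'a::real_normed_vector \<Rightarrow> 'a"
  assumes "\<exists>B :: 'a set. finite B \<and> span B = UNIV"
    and "nonexpansive T"
  shows "((\<forall>g. \<exists>x. g + T x = x) \<longleftrightarrow>
          (\<forall>G. nonexpansive G \<and> bdd_above (range (\<lambda>x. norm (G x - T x))) \<longrightarrow> (\<exists>x. G x = x)))
       \<and> ((\<forall>G. nonexpansive G \<and> bdd_above (range (\<lambda>x. norm (G x - T x))) \<longrightarrow> (\<exists>x. G x = x)) \<longleftrightarrow>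
          (\<forall>\<alpha>\<ge>0. bounded (approx_fixed_set \<alpha> T)))"
    (is "(?translates \<longleftrightarrow> ?perturbations) \<and> (_ \<longleftrightarrow> ?bounded)")
proof -
  have boundedly_compact_UNIV: "boundedly_compact (UNIV :: 'a set)"
    using assms(1) boundedly_compact_span_finite by metis
  have ?perturbations if ?bounded
    using bounded_perturbation_fixed_point[OF boundedly_compact_UNIV] that by metis
  moreover have ?translates if perturbations: ?perturbations
  proof
    fix g
    show "\<exists>x. g + T x = x"
      using perturbations[rule_format, of "\<lambda>x. g + T x"] nonexpansive_translate[OF assms(2)] by simp
  qed
  moreover have ?bounded if ?translates
    using bounded_approx_fixed_set_if_translates_fixed[OF boundedly_compact_UNIV assms(2)] that by blast
  ultimately show ?thesis
    by argo
qed

end
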